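(* Let $k$ be a positive integer. If $k=3\cdot 2^m$ for some positive integer $m$, then $f_2(k)=3k^2$; and if $k=p^m$ for some odd prime number $p$ and some positive integer $m$, then $f_2(k)\geq 3k^2+1$.
   Context: For an integer $k\geq 2$, $f_2(k)$ denotes the smallest positive integer $n$ such that every $2$-coloring of $\{1,2,\ldots,n\}$ (i.e. every map from $\{1,\ldots,n\}$ to a set of two colors) has a monochromatic solution to the equation \[ \frac{1}{x_1}+\frac{1}{x_2}+\cdots+\frac{1}{x_k}=\frac{1}{x_{k+1}}, \] that is, there are $x_1,\ldots,x_{k+1}\in\{1,\ldots,n\}$ satisfying the equation and all having the same color; $x_1,\ldots,x_k$ are not necessarily distinct. It is known (Brown–Rödl, Lefmann) that such an $n$ exists for all $k\geq 2$, so $f_2(k)$ is well defined. *)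

theory Defs
  imports Complex_Main "HOL-Computational_Algebra.Primes"
begin

definition unit_frac_solution :: "nat \<Rightarrow> nat \<Rightarrow> (nat \<Rightarrow> nat) \<Rightarrow> bool" where
  "unit_frac_solution k n x \<longleftrightarrow>
     (\<forall>i\<in>{1..k+1}. x i \<in> {1..n}) \<and>
     (\<Sum>i=1..k. 1 / real (x i)) = 1 / real (x (k+1))"

text \<open>
  The two colors are the elements of \<^typ>\<open>bool\<close>. Colorings are total functions on \<^typ>\<open>nat\<close>,
  but only their values on \<open>{1..n}\<close> matter; every map on \<open>{1..n}\<close> is such a restriction.
\<close>

definition mono_solution :: "nat \<Rightarrow> nat \<Rightarrow> (nat \<Rightarrow> bool) \<Rightarrow> bool" where
  "mono_solution k n c \<longleftrightarrow>
     (\<exists>x. unit_frac_solution k n x \<and> (\<exists>a. \<forall>i\<in>{1..k+1}. c (x i) = a))"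

text \<open>
  A \<open>LEAST\<close> says nothing if no witness exists; here one exists for all \<open>k \<ge> 2\<close> by
  theorems of Brown and Roedl and Lefmann, so \<open>f2 k\<close> is the true
  minimum for such \<open>k\<close>.
\<close>

definition f2 :: "nat \<Rightarrow> nat" where
  "f2 k = (LEAST n. 0 < n \<and> (\<forall>c :: nat \<Rightarrow> bool. mono_solution k n c))"

end

theory Submission
  imports Defs
begin

text \<open>
  Lower bounds: color \<open>{3..<3k}\<close> red and the other numbers below \<open>3k\<^sup>2\<close> blue. A sum of \<open>k\<close> red unit
  fractions exceeds \<open>1/3\<close>. Among the blue numbers, those \<open>\<ge> 3k\<close> contribute at most \<open>1/3\<close>, too little
  to fill a gap between half-integers. If \<open>k\<close> is a power of an odd prime \<open>p\<close>, then \<open>3k\<^sup>2\<close> can be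
  colored red as well: its reciprocal has such a large power of \<open>p\<close> in the denominator that it
  could only occur a multiple of \<open>k\<close> times, hence \<open>k\<close> times, which forces the right-hand side
  \<open>1/(3k)\<close>, and \<open>3k\<close> is blue.

  Upper bound for \<open>k = 3\<cdot>2\<^sup>m\<close>: \<open>y\<close> and \<open>ky\<close> always have different colors. If the color changes
  somewhere in the chain \<open>3, 6, 12, \<dots>, k\<close>, say between \<open>3w\<close> and \<open>6w\<close>, a few multiples of \<open>w\<close> and of
  \<open>kw\<close> already contain a solution; otherwise \<open>3\<close>, \<open>6\<close> and \<open>k\<close> have one color, and a few numbers of
  the orders \<open>1\<close>, \<open>k\<close>, \<open>k\<^sup>2\<close> suffice. All these solutions have at most three distinct summands.
\<close>

subsection \<open>Solutions with at most three distinct summands\<close>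

lemma mono_solution_mono:
  assumes "mono_solution k n c" "n \<le> n'"
  shows "mono_solution k n' c"
  using assms unfolding mono_solution_def unit_frac_solution_def by fastforce

lemma mono_solution3I:
  fixes x1 x2 x3 y :: nat
  assumes counts: "n1 + n2 + n3 = k"
    and eq: "real n1 / x1 + real n2 / x2 + real n3 / x3 = 1 / y"
    and range: "{x1, x2, x3, y} \<subseteq> {1..n}"
    and colors: "c x1 = c y" "c x2 = c y" "c x3 = c y"
  shows "mono_solution k n c"
proof -
  define x where
    "x i = (if i \<le> n1 then x1 else if i \<le> n1 + n2 then x2 else if i \<le> k then x3 else y)" for i
  have split: "{1..k} = {1..n1} \<union> {n1<..n1+n2} \<union> {n1+n2<..k}"
    using counts by auto
  have "(\<Sum>i=1..k. 1 / real (x i)) = (\<Sum>i\<in>{1..n1}. 1 / real (x i))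
      + (\<Sum>i\<in>{n1<..n1+n2}. 1 / real (x i)) + (\<Sum>i\<in>{n1+n2<..k}. 1 / real (x i))"
    unfolding split by (subst sum.union_disjoint; auto)+
  also have "(\<Sum>i\<in>{1..n1}. 1 / real (x i)) = (\<Sum>i\<in>{1..n1}. 1 / real x1)"
    by (rule sum.cong) (auto simp: x_def)
  also have "(\<Sum>i\<in>{n1<..n1+n2}. 1 / real (x i)) = (\<Sum>i\<in>{n1<..n1+n2}. 1 / real x2)"
    by (rule sum.cong) (auto simp: x_def)
  also have "(\<Sum>i\<in>{n1+n2<..k}. 1 / real (x i)) = (\<Sum>i\<in>{n1+n2<..k}. 1 / real x3)"
    by (rule sum.cong) (auto simp: x_def)
  finally have "(\<Sum>i=1..k. 1 / real (x i)) = 1 / real (x (k+1))"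
    using eq counts by (auto simp: x_def)
  moreover have "\<forall>i\<in>{1..k+1}. x i \<in> {1..n}" "\<forall>i\<in>{1..k+1}. c (x i) = c y"
    using range colors by (auto simp: x_def)
  ultimately show ?thesis
    unfolding mono_solution_def unit_frac_solution_def by blast
qed

lemma no_mono_solution3:
  fixes x1 x2 x3 y :: nat
  assumes "\<not> mono_solution k n c"
    and "real n1 / x1 + real n2 / x2 + real n3 / x3 = 1 / y"
    and "n1 + n2 + n3 = k" "{x1, x2, x3, y} \<subseteq> {1..n}"
  shows "\<not> (c x1 = c y \<and> c x2 = c y \<and> c x3 = c y)"
  using mono_solution3I assms by blast

lemma no_mono_solution2:
  fixes x1 x2 y :: nat
  assumes "\<not> mono_solution k n c"
    and "real n1 / x1 + real n2 / x2 = 1 / y"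
    and "n1 + n2 = k" "{x1, x2, y} \<subseteq> {1..n}"
  shows "\<not> (c x1 = c y \<and> c x2 = c y)"
  using no_mono_solution3[of k n c n1 x1 n2 x2 0 x2 y] assms by auto

text \<open>\<open>k\<close> copies of \<open>1 / (k * y)\<close> sum to
  \<open>1 / y\<close>.\<close>

lemma no_mono_solution_multiple:
  fixes y :: nat
  assumes "\<not> mono_solution k n c" "0 < y" "k * y \<le> n" "0 < k"
  shows "c (k * y) \<noteq> c y"
proof -
  have "y \<le> k * y"
    using assms(4) by simp
  also note assms(3)
  finally have "{k * y, k * y, y} \<subseteq> {1..n}"
    using assms by auto
  then show ?thesis
    using no_mono_solution2[of k n c k "k * y" 0 "k * y" y] assms by auto
qed

subsection \<open>Existence\<close>

text \<open>
  The numbers \<open>L\<close>, \<open>L/k\<close>, \<open>L/k\<^sup>2\<close>, \<open>L/(k+1)\<close>, \<open>L/(k\<^sup>2+k-1)\<close> suffice for a suitable \<open>L\<close>: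
  their reciprocals are proportional to the numbers that show that the two-color Rado number of
  \<open>z\<^sub>1 + \<dots> + z\<^sub>k = z\<close> is at most \<open>k\<^sup>2 + k - 1\<close>.
\<close>

lemma ex_mono_solution:
  assumes "2 \<le> k"
  shows "\<exists>n>0. \<forall>c. mono_solution k n c"
proof -
  obtain q where q: "q + 1 = k\<^sup>2 + k"
    using assms by (metis add.commute add_gr_0 less_le_trans less_imp_Suc_add pos2 Suc_eq_plus1)
  have rq: "real q = (real k)\<^sup>2 + k - 1"
    using arg_cong[OF q, of real] by simp
  have q0: "0 < q"
    using q assms by (cases q) auto
  have k0: "0 < k" using assms by simp
  define L where "L = k\<^sup>2 * (k + 1) * q"
  have L0: "0 < L" using k0 q0 by (simp add: L_def)
  have "mono_solution k L c" for c
  proof (rule ccontr)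
    assume no: "\<not> mono_solution k L c"
    \<comment> \<open>In order: \<open>L / k\<close>, \<open>L / k\<^sup>2\<close>,
      \<open>L / (k + 1)\<close> and \<open>L / q\<close>.\<close>
    let ?k = "k * (k + 1) * q" and ?kk = "(k + 1) * q" and ?k1 = "k\<^sup>2 * q" and ?q = "k\<^sup>2 * (k + 1)"
    have "L = ?k * k" "L = ?kk * k\<^sup>2" "L = ?k1 * (k + 1)" "L = ?q * q"
      by (simp_all add: L_def power2_eq_square algebra_simps)
    then have "?k dvd L" "?kk dvd L" "?k1 dvd L" "?q dvd L"
      by (metis dvd_triv_left)+
    then have range: "L \<in> {1..L}" "?k \<in> {1..L}" "?kk \<in> {1..L}" "?k1 \<in> {1..L}" "?q \<in> {1..L}"
      using L0 k0 q0 by (auto dest: dvd_imp_le simp: Suc_le_eq)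
    have "c ?k \<noteq> c L"
      using no_mono_solution_multiple[OF no, of ?k] range k0
      by (auto simp: L_def power2_eq_square mult_ac)
    moreover have "k * ?kk = ?k"
      by (simp only: mult.assoc)
    then have "c ?kk \<noteq> c ?k"
      using no_mono_solution_multiple[OF no, of ?kk] range k0 by fastforce
    \<comment> \<open>Multiplied by \<open>L\<close>, these read
      \<open>k\<^sup>2 + (k-1) = q\<close>, \<open>k + (k-1)(k+1) = q\<close> and
      \<open>1 + (k-1)(k+1) = k\<^sup>2\<close>.\<close>
    moreover have "real 1 / ?kk + real (k - 1) / L = 1 / ?q"
      "real 1 / ?k + real (k - 1) / ?k1 = 1 / ?q"
      "real 1 / L + real (k - 1) / ?k1 = 1 / ?kk"
      unfolding L_def of_nat_mult of_nat_power of_nat_add of_nat_diff[OF Suc_leI[OF k0, folded One_nat_def]]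
      using k0 q0 by (simp_all add: divide_simps add_eq_0_iff, auto simp: rq algebra_simps power2_eq_square)
    then have "\<not> (c ?kk = c ?q \<and> c L = c ?q)"
      "\<not> (c ?k = c ?q \<and> c ?k1 = c ?q)"
      "\<not> (c L = c ?kk \<and> c ?k1 = c ?kk)"
      using no_mono_solution2[OF no _ _, of 1 _ "k - 1"] range k0 by simp_all
    ultimately show False by blast
  qed
  with L0 show ?thesis by blast
qed

subsection \<open>The upper bound\<close>

text \<open>With \<open>k = 6 * h\<close> the bound is \<open>3 * k\<^sup>2\<close>. Avoiding
  solutions forces one color on \<open>2 * w\<close>, \<open>3 * w\<close>, \<open>4 * w\<close>,
  \<open>36 * (w * h)\<close> and the other on \<open>6 * w\<close> and on \<open>9\<close>,
  \<open>18\<close>, \<open>24\<close>, \<open>72\<close> times \<open>w * h\<close>, until the last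
  equation becomes monochromatic.\<close>

lemma mono_solution_of_color_switch:
  fixes h w :: nat
  assumes w: "0 < w" "2 * w \<le> 3 * h" and switch: "c (3 * w) \<noteq> c (6 * w)"
  shows "mono_solution (6 * h) (108 * h\<^sup>2) c"
proof (rule ccontr)
  assume no: "\<not> mono_solution (6 * h) (108 * h\<^sup>2) c"
  have h: "0 < h" using w by simp
  \<comment> \<open>\<open>72 * (w * h)\<close> is the largest number used below;
    \<open>2 * w \<le> 3 * h\<close> keeps it in range.\<close>
  have top: "72 * (w * h) \<le> 108 * h\<^sup>2"
    using mult_right_mono[OF w(2), of "36 * h"] by (simp add: power2_eq_square)
  have "w \<le> w * h" using h by simp
  with top have "2 * w \<le> 3 * h\<^sup>2" by linarith
  note range = this top w(1) h
  have mult: "c (6 * h * (t * w)) \<noteq> c (t * w)" if "0 < t" "t \<le> 12" for t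
  proof (rule no_mono_solution_multiple[OF no])
    have "6 * h * (t * w) = 6 * t * (w * h)"
      by (simp add: mult_ac)
    also have "\<dots> \<le> 72 * (w * h)"
      using that by (intro mult_right_mono) auto
    also note top
    finally show "6 * h * (t * w) \<le> 108 * h\<^sup>2" .
  qed (use that range in auto)
  have 3: "c (18 * (w * h)) \<noteq> c (3 * w)" and 6: "c (36 * (w * h)) \<noteq> c (6 * w)"
    and 4: "c (24 * (w * h)) \<noteq> c (4 * w)"
    using mult[of 3] mult[of 6] mult[of 4] by (simp_all add: mult_ac)
  have a: "c (36 * (w * h)) = c (3 * w)"
    using 6 switch by auto
  have "\<not> (c (9 * (w * h)) = c (3 * w) \<and> c (36 * (w * h)) = c (3 * w))"
    by (rule no_mono_solution2[OF no, of "2 * h" _ "4 * h"]) (use range in \<open>auto simp: field_simps\<close>)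
  then have b: "c (9 * (w * h)) = c (6 * w)"
    using a switch by auto
  have "\<not> (c (9 * (w * h)) = c (2 * w) \<and> c (18 * (w * h)) = c (2 * w))"
    by (rule no_mono_solution2[OF no, of "3 * h" _ "3 * h"]) (use range in \<open>auto simp: field_simps\<close>)
  then have d: "c (2 * w) = c (3 * w)"
    using b 3 switch by auto
  \<comment> \<open>\<open>6 * h\<close> copies of \<open>1 / (36 * (w * h))\<close> give
    \<open>1 / (6 * w)\<close>. Trading three of them for two copies of
    \<open>1 / (24 * (w * h))\<close> frees a place for \<open>1 / (3 * w)\<close>.\<close>
  have "\<not> (c (3 * w) = c (2 * w) \<and> c (24 * (w * h)) = c (2 * w) \<and> c (36 * (w * h)) = c (2 * w))"
    by (rule no_mono_solution3[OF no, of 1 _ 2 _ "6 * h - 3"])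
      (use range in \<open>auto simp: field_simps of_nat_diff\<close>)
  then have e: "c (24 * (w * h)) = c (6 * w)" and f: "c (4 * w) = c (3 * w)"
    using a d switch 4 by auto
  \<comment> \<open>The same trade: two of \<open>6 * h\<close> copies of
    \<open>1 / (72 * (w * h))\<close> merge into one \<open>1 / (36 * (w * h))\<close>, making room
    for \<open>1 / (4 * w)\<close>.\<close>
  have "\<not> (c (4 * w) = c (3 * w) \<and> c (36 * (w * h)) = c (3 * w) \<and> c (72 * (w * h)) = c (3 * w))"
    by (rule no_mono_solution3[OF no, of 1 _ 1 _ "6 * h - 2"])
      (use range in \<open>auto simp: field_simps of_nat_diff\<close>)
  then have g: "c (72 * (w * h)) = c (6 * w)"
    using a f switch by auto
  have "\<not> (c (24 * (w * h)) = c (6 * w) \<and> c (72 * (w * h)) = c (6 * w))"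
    by (rule no_mono_solution2[OF no, of "3 * h" _ "3 * h"]) (use range in \<open>auto simp: field_simps\<close>)
  with e g show False by blast
qed

text \<open>The case of a constant chain when \<open>4\<close> divides \<open>k = 12 * h\<close>.
  The color of \<open>3\<close> is forced on \<open>4\<close>, \<open>16 * h\<close> and
  \<open>432 * h\<^sup>2\<close>, which together with \<open>12 * h\<close> form a solution with sum
  \<open>1 / 4\<close>.\<close>

lemma mono_solution_dvd12:
  fixes h :: nat
  assumes h: "0 < h" and colors: "c 6 = c 3" "c (12 * h) = c 3"
  shows "mono_solution (12 * h) (432 * h\<^sup>2) c"
proof (rule ccontr)
  assume no: "\<not> mono_solution (12 * h) (432 * h\<^sup>2) c"
  have hh: "h \<le> h\<^sup>2" "1 \<le> h\<^sup>2"
    using h by (simp_all add: power2_eq_square)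
  note range = h hh
  note simps = field_simps of_nat_diff power2_eq_square
  have mult: "c (12 * h * y) \<noteq> c y" if "0 < y" "y \<le> 36 * h" for y
    using no_mono_solution_multiple[OF no, of y] mult_left_mono[OF that(2), of "12 * h"] that h
    by (simp add: power2_eq_square)
  have 1: "c 1 \<noteq> c 3"
    using mult[of 1] colors h by simp
  have 2: "c (36 * h) \<noteq> c 3" "c (72 * h) \<noteq> c 3" "c (144 * h\<^sup>2) \<noteq> c 3"
    using mult[of 3] mult[of 6] mult[of "12 * h"] colors h by (auto simp: power2_eq_square mult_ac)
  then have 3: "c (432 * h\<^sup>2) = c 3"
    using mult[of "36 * h"] h by (auto simp: power2_eq_square mult_ac)
  have "\<not> (c (36 * h) = c 4 \<and> c (72 * h) = c 4)"
    by (rule no_mono_solution2[OF no, of "6 * h" _ "6 * h"]) (use range in \<open>auto simp: simps\<close>)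
  then have 4: "c 4 = c 3"
    using 2 by auto
  have "\<not> (c (9 * h) = c 1 \<and> c (36 * h) = c 1)"
    by (rule no_mono_solution2[OF no, of "8 * h" _ "4 * h"]) (use range in \<open>auto simp: simps\<close>)
  then have 5: "c (9 * h) = c 3"
    using 1 2 by auto
  have "\<not> (c (12 * h) = c (9 * h) \<and> c (288 * h\<^sup>2) = c (9 * h) \<and> c (432 * h\<^sup>2) = c (9 * h))"
    by (rule no_mono_solution3[OF no, of 1 _ 2 _ "12 * h - 3"]) (use range in \<open>auto simp: simps\<close>)
  then have 6: "c (288 * h\<^sup>2) \<noteq> c 3"
    using 3 5 colors by auto
  have "\<not> (c (144 * h\<^sup>2) = c (16 * h) \<and> c (288 * h\<^sup>2) = c (16 * h))"
    by (rule no_mono_solution2[OF no, of "6 * h" _ "6 * h"]) (use range in \<open>auto simp: simps\<close>)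
  then have 7: "c (16 * h) = c 3"
    using 2 6 by auto
  \<comment> \<open>Of \<open>3 * h\<close> copies of \<open>1 / (12 * h)\<close>, summing to
    \<open>1 / 4\<close>, one is split as \<open>1 / (16 * h) + 1 / (48 * h)\<close>; the last part
    becomes \<open>9 * h\<close> copies of \<open>1 / (432 * h\<^sup>2)\<close>.\<close>
  have "\<not> (c (12 * h) = c 4 \<and> c (16 * h) = c 4 \<and> c (432 * h\<^sup>2) = c 4)"
    by (rule no_mono_solution3[OF no, of "3 * h - 1" _ 1 _ "9 * h"]) (use range in \<open>auto simp: simps\<close>)
  then show False
    using 3 4 7 colors by auto
qed

text \<open>The case \<open>m = 1\<close> of a constant chain, where \<open>k = 6\<close> is not a
  multiple of \<open>12\<close>.\<close>

lemma mono_solution_6: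
  assumes "c 6 = c (3::nat)"
  shows "mono_solution 6 108 c"
proof (rule ccontr)
  assume no: "\<not> mono_solution 6 108 c"
  have mult: "c (6 * y) \<noteq> c y" if "0 < y" "y \<le> 18" for y
    using no_mono_solution_multiple[OF no, of y] that by simp
  have 1: "c 18 \<noteq> c 3" "c 36 \<noteq> c 3"
    using mult[of 3] mult[of 6] assms by simp_all
  then have 2: "c 108 = c 3"
    using mult[of 18] by simp
  have "\<not> (c 18 = c 4 \<and> c 36 = c 4)"
    by (rule no_mono_solution2[OF no, of 3 _ 3]) auto
  then have 3: "c 4 = c 3"
    using 1 by auto
  \<comment> \<open>Since \<open>54 = 6 * 9\<close>, barring \<open>54\<close> from the color of
    \<open>3\<close> puts \<open>9\<close> into it.\<close>
  have "\<not> (c 4 = c 3 \<and> c 54 = c 3 \<and> c 108 = c 3)"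
    by (rule no_mono_solution3[OF no, of 1 _ 4 _ 1]) auto
  then have 4: "c 9 = c 3"
    using 2 3 mult[of 9] by auto
  have "\<not> (c 4 = c 2 \<and> c 9 = c 2 \<and> c 108 = c 2)"
    by (rule no_mono_solution3[OF no, of 1 _ 2 _ 3]) auto
  then have 5: "c 12 = c 3"
    using 2 3 4 mult[of 2] by auto
  have "\<not> (c 9 = c 3 \<and> c 12 = c 3 \<and> c 108 = c 3)"
    by (rule no_mono_solution3[OF no, of 2 _ 1 _ 3]) auto
  then show False
    using 2 4 5 by auto
qed

lemma mono_solution_3_mult_power2:
  assumes "0 < m" and k: "k = 3 * 2 ^ m"
  shows "mono_solution k (3 * k\<^sup>2) c"
proof (rule ccontr)
  assume no: "\<not> mono_solution k (3 * k\<^sup>2) c"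
  obtain j where m: "m = Suc j"
    using assms(1) gr0_implies_Suc by blast
  \<comment> \<open>No switch can occur along the chain: \<open>w = 2 ^ i\<close> and
    \<open>h = 2 ^ j\<close> meet the size condition because \<open>i \<le> j\<close> in every
    step.\<close>
  have "c (3 * 2 ^ i) = c 3" if "i \<le> m" for i
    using that
  proof (induction i)
    case (Suc i)
    have "(2::nat) ^ i \<le> 2 ^ j"
      using Suc.prems m by (intro power_increasing) auto
    then have "2 * 2 ^ i \<le> 3 * (2 ^ j :: nat)"
      by linarith
    then have "c (3 * 2 ^ i) = c (6 * 2 ^ i)"
      using mono_solution_of_color_switch[of "2 ^ i" "2 ^ j" c] no k m
      by (auto simp: power_mult_distrib)
    then show ?case
      using Suc by simp
  qed simp
  from this[of 1] this[of m] assms have colors: "c 6 = c 3" "c k = c 3"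
    by simp_all
  show False
  proof (cases j)
    case 0
    then show ?thesis
      using mono_solution_6[of c] colors no k m by simp
  next
    case (Suc l)
    then show ?thesis
      using mono_solution_dvd12[of "2 ^ l" c] colors no k m by (simp add: power_mult_distrib)
  qed
qed

subsection \<open>The lower bounds\<close>

text \<open>All \<open>x i\<close> are below \<open>3 * k\<^sup>2\<close>, so the sum exceeds
  \<open>1 / (3 * k)\<close> and \<open>y\<close> is \<open>1\<close> or \<open>2\<close>. The part
  \<open>R\<close> of the sum with \<open>x i > 2\<close> is then a half-integer in
  \<open>[0, 1/3]\<close>, hence \<open>0\<close>; but \<open>k\<close> terms of size at least
  \<open>1 / 2\<close> exceed \<open>1\<close>.\<close>

lemma no_blue_solution:
  fixes x :: "nat \<Rightarrow> nat"
  assumes k: "3 \<le> k"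
    and blue: "\<And>i. i \<in> {1..k} \<Longrightarrow> x i \<in> {1, 2} \<union> {3 * k..<3 * k\<^sup>2}"
      "y \<in> {1, 2} \<union> {3 * k..<3 * k\<^sup>2}"
  shows "(\<Sum>i=1..k. 1 / real (x i)) \<noteq> 1 / real y"
proof
  assume eq: "(\<Sum>i=1..k. 1 / real (x i)) = 1 / real y"
  have pos: "0 < x i" if "i \<in> {1..k}" for i
    using blue(1)[OF that] k by auto
  have "real k * (1 / real (3 * k\<^sup>2)) = (\<Sum>i=1..k. 1 / real (3 * k\<^sup>2))"
    by simp
  also have "\<dots> < (\<Sum>i=1..k. 1 / real (x i))"
  proof (rule sum_strict_mono)
    fix i assume i: "i \<in> {1..k}"
    have "3 * k \<le> 3 * k\<^sup>2" using k by (simp add: power2_eq_square)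
    then have "x i < 3 * k\<^sup>2" using blue(1)[OF i] k by auto
    then show "1 / real (3 * k\<^sup>2) < 1 / real (x i)"
      using pos[OF i] k by (intro divide_strict_left_mono) (auto simp del: of_nat_mult of_nat_power)
  qed (use k in auto)
  finally have "1 / real (3 * k) < 1 / real y"
    using k eq by (simp add: power2_eq_square)
  then have y: "y \<in> {1, 2}"
    using blue(2) k by (auto simp: field_simps)
  define J where "J = {i \<in> {1..k}. x i \<le> 2}"
  have fin: "finite J" "J \<subseteq> {1..k}"
    by (auto simp: J_def)
  define R where "R = (\<Sum>i\<in>{1..k} - J. 1 / real (x i))"
  have split: "1 / real y = (\<Sum>i\<in>J. 1 / real (x i)) + R"
    using sum.subset_diff[OF fin(2), of "\<lambda>i. 1 / real (x i)"] eq by (simp add: R_def)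
  have "R \<le> (\<Sum>i\<in>{1..k} - J. 1 / real (3 * k))"
    unfolding R_def
  proof (rule sum_mono)
    fix i assume "i \<in> {1..k} - J"
    then have "3 * k \<le> x i" using blue(1)[of i] by (auto simp: J_def)
    then show "1 / real (x i) \<le> 1 / real (3 * k)"
      using k by (intro divide_left_mono) (auto simp del: of_nat_mult)
  qed
  also have "\<dots> \<le> (\<Sum>i\<in>{1..k}. 1 / real (3 * k))"
    by (rule sum_mono2) auto
  also have "\<dots> = 1 / 3" using k by simp
  finally have R_le: "R \<le> 1 / 3" .
  have half: "2 * (1 / real t) \<in> \<int>" if "t \<in> {1, 2}" for t :: nat
    using that by auto
  have "2 * (\<Sum>i\<in>J. 1 / real (x i)) \<in> \<int>"
    unfolding sum_distrib_left
  proof (rule Ints_sum)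
    fix i assume "i \<in> J"
    then show "2 * (1 / real (x i)) \<in> \<int>"
      using blue(1)[of i] k by (intro half) (auto simp: J_def)
  qed
  then have "2 * R \<in> \<int>"
    using Ints_diff[OF half[OF y]] split by (simp add: algebra_simps)
  moreover have "0 \<le> R"
    unfolding R_def by (rule sum_nonneg) auto
  moreover have "\<bar>2 * R\<bar> < 1"
    using R_le \<open>0 \<le> R\<close> by simp
  ultimately have "R = 0"
    using Ints_nonzero_abs_less1[of "2 * R"] by simp
  then have "{1..k} - J = {}"
    using pos sum_pos[of "{1..k} - J" "\<lambda>i. 1 / real (x i)"] unfolding R_def
    by (cases "{1..k} - J = {}") force+
  then have "x i \<le> 2" if "i \<in> {1..k}" for i
    using that by (auto simp: J_def)
  then have "(\<Sum>i=1..k. 1 / 2) \<le> (\<Sum>i=1..k. 1 / real (x i))"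
    using pos by (intro sum_mono) (force simp: field_simps)
  then show False
    using eq y k by (auto simp: field_simps)
qed

lemma no_red_solution:
  fixes x :: "nat \<Rightarrow> nat"
  assumes k: "0 < k" and red: "\<And>i. i \<in> {1..k} \<Longrightarrow> x i \<in> {3..<3 * k}" "3 \<le> y"
  shows "(\<Sum>i=1..k. 1 / real (x i)) \<noteq> 1 / real y"
proof
  assume eq: "(\<Sum>i=1..k. 1 / real (x i)) = 1 / real y"
  have "1 / 3 = (\<Sum>i=1..k. 1 / real (3 * k))"
    using k by simp
  also have "\<dots> < (\<Sum>i=1..k. 1 / real (x i))"
  proof (rule sum_strict_mono)
    fix i assume "i \<in> {1..k}"
    then show "1 / real (3 * k) < 1 / real (x i)"
      using red(1)[of i] by (intro divide_strict_left_mono) (auto simp del: of_nat_mult)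
  qed (use k in auto)
  also have "\<dots> \<le> 1 / 3"
    unfolding eq using red(2) by (simp add: field_simps)
  finally show False
    by simp
qed

lemma no_mono_solution_below:
  assumes k: "3 \<le> k" and n: "n < 3 * k\<^sup>2"
  shows "\<not> mono_solution k n (\<lambda>x. 3 \<le> x \<and> x < 3 * k)"
proof
  assume "mono_solution k n (\<lambda>x. 3 \<le> x \<and> x < 3 * k)"
  then obtain x a where range: "\<And>i. i \<in> {1..k+1} \<Longrightarrow> x i \<in> {1..n}"
    and eq: "(\<Sum>i=1..k. 1 / real (x i)) = 1 / real (x (k+1))"
    and col: "\<And>i. i \<in> {1..k+1} \<Longrightarrow> (3 \<le> x i \<and> x i < 3 * k) = a"
    unfolding mono_solution_def unit_frac_solution_def by blast
  show False
  proof (cases a)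
    case True
    then show False
      using no_red_solution[of k x "x (k+1)"] eq col k by auto
  next
    case False
    have "x i \<in> {1, 2} \<union> {3 * k..<3 * k\<^sup>2}" if "i \<in> {1..k+1}" for i
      using range[OF that] col[OF that] False n by auto
    then show False
      using no_blue_solution[of k x "x (k+1)"] eq k by auto
  qed
qed

text \<open>\<open>d\<close> is the product of the prime-to-\<open>p\<close> parts of the elements.
  For \<open>k = p ^ m\<close> this yields a common denominator \<open>k * d\<close> of the
  reciprocals of all red numbers below \<open>3 * k\<close>.\<close>

lemma common_multiple_prime_power:
  fixes A :: "nat set"
  assumes "prime p" "finite A" "\<And>x. x \<in> A \<Longrightarrow> \<not> p ^ Suc m dvd x"
  shows "\<exists>d. coprime p d \<and> (\<forall>x\<in>A. x dvd p ^ m * d)"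
  using assms(2,3)
proof (induction A)
  case empty
  show ?case by (rule exI[of _ 1]) simp
next
  case (insert x A)
  then obtain d where d: "coprime p d" "\<forall>z\<in>A. z dvd p ^ m * d"
    by auto
  have x: "\<not> p ^ Suc m dvd x" using insert.prems by simp
  then have "x \<noteq> 0" by (metis dvd_0_right)
  moreover have "\<not> is_unit p" using assms(1) by auto
  ultimately obtain u where u: "x = p ^ multiplicity p x * u" "\<not> p dvd u"
    using multiplicity_decompose' by metis
  have "\<not> Suc m \<le> multiplicity p x"
    using x multiplicity_dvd' by blast
  then have "x dvd p ^ m * u"
    by (subst u(1)) (intro mult_dvd_mono le_imp_power_dvd, auto)
  then have "x dvd p ^ m * (d * u)"
    by (metis dvd_mult2 mult.assoc mult.commute)
  moreover have "z dvd p ^ m * (d * u)" if "z \<in> A" for z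
    using d(2) that by (metis dvd_mult2 mult.assoc)
  moreover have "coprime p (d * u)"
    using d(1) u(2) assms(1) by (simp add: prime_imp_coprime)
  ultimately show ?case
    by (intro exI[of _ "d * u"]) simp
qed

lemma no_mono_solution_prime_power:
  assumes p: "prime p" "odd p" and m: "0 < m" and k: "k = p ^ m"
  shows "\<not> mono_solution k (3 * k\<^sup>2) (\<lambda>x. 3 \<le> x \<and> x < 3 * k \<or> x = 3 * k\<^sup>2)"
proof
  assume "mono_solution k (3 * k\<^sup>2) (\<lambda>x. 3 \<le> x \<and> x < 3 * k \<or> x = 3 * k\<^sup>2)"
  then obtain x a where range: "\<And>i. i \<in> {1..k+1} \<Longrightarrow> x i \<in> {1..3 * k\<^sup>2}"
    and eq: "(\<Sum>i=1..k. 1 / real (x i)) = 1 / real (x (k+1))"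
    and col: "\<And>i. i \<in> {1..k+1} \<Longrightarrow> (3 \<le> x i \<and> x i < 3 * k \<or> x i = 3 * k\<^sup>2) = a"
    unfolding mono_solution_def unit_frac_solution_def by blast
  define y where "y = x (k+1)"
  have p3: "3 \<le> p"
    using p prime_ge_2_nat[of p] by (cases "p = 2") auto
  have k3: "3 \<le> k"
    using power_increasing[of 1 m p] p3 m by (simp add: k)
  have k_less: "3 * k < 3 * k\<^sup>2"
    using k3 by (simp add: power2_eq_square)
  show False
  proof (cases a)
    case False
    have "x i \<in> {1, 2} \<union> {3 * k..<3 * k\<^sup>2}" if "i \<in> {1..k+1}" for i
      using range[OF that] col[OF that] False by auto
    then show False
      using no_blue_solution[of k x "x (k+1)"] eq k3 by auto
  next
    case True
    have red: "x i \<in> {3..<3 * k} \<or> x i = 3 * k\<^sup>2" if "i \<in> {1..k+1}" for i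
      using col[OF that] True by auto
    have y0: "0 < y" using range[of "k+1"] by (simp add: y_def)
    \<comment> \<open>Every \<open>x i\<close> is at most \<open>3 * k\<^sup>2\<close>, so
      \<open>y \<le> 3 * k\<close>; as \<open>3 * k\<close> is blue, \<open>y\<close> lies in the
      red interval.\<close>
    have "1 / real (3 * k) = (\<Sum>i=1..k. 1 / real (3 * k\<^sup>2))"
      using k3 by (simp add: power2_eq_square)
    also have "\<dots> \<le> (\<Sum>i=1..k. 1 / real (x i))"
    proof (rule sum_mono)
      fix i assume "i \<in> {1..k}"
      then show "1 / real (3 * k\<^sup>2) \<le> 1 / real (x i)"
        using range[of i] by (intro divide_left_mono) (auto simp del: of_nat_mult of_nat_power)
    qed
    finally have "1 / real (3 * k) \<le> 1 / real y"
      by (simp only: eq y_def)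
    then have "y \<le> 3 * k"
      using y0 k3 by (simp add: field_simps)
    then have y: "3 \<le> y" "y < 3 * k"
      using red[of "k+1"] k_less by (auto simp: y_def)
    define J where "J = {i \<in> {1..k}. x i = 3 * k\<^sup>2}"
    have J: "finite J" "J \<subseteq> {1..k}"
      by (auto simp: J_def)
    \<comment> \<open>\<open>p \<ge> 3\<close> makes \<open>p ^ Suc m = p * k\<close> at least
      \<open>3 * k\<close>.\<close>
    have "\<not> p ^ Suc m dvd t" if "t \<in> {1..<3 * k}" for t
    proof
      assume "p ^ Suc m dvd t"
      then have "p * k \<le> t" using that by (auto simp: k dest: dvd_imp_le)
      moreover have "3 * k \<le> p * k" using p3 by simp
      ultimately show False
        using that unfolding atLeastLessThan_iff by linarith
    qed
    then obtain d where d: "coprime p d" "\<forall>t\<in>{1..<3 * k}. t dvd k * d"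
      using common_multiple_prime_power[OF p(1), of "{1..<3 * k}" m] by (auto simp: k)
    have int: "real (k * d) * (1 / real t) \<in> \<int>" if "t \<in> {1..<3 * k}" for t
    proof -
      have "t dvd k * d" using d(2) that by blast
      then obtain s where s: "k * d = t * s" by (rule dvdE)
      show ?thesis using that unfolding s by simp
    qed
    have "(\<Sum>i\<in>J. 1 / real (x i)) = real (card J) / real (3 * k\<^sup>2)"
      by (simp add: J_def)
    then have "real (card J) / real (3 * k\<^sup>2) = 1 / real y - (\<Sum>i\<in>{1..k} - J. 1 / real (x i))"
      using sum.subset_diff[OF J(2), of "\<lambda>i. 1 / real (x i)"] eq by (simp add: y_def)
    \<comment> \<open>Scaling by \<open>k * d\<close> turns all other terms into integers, so
      \<open>d * card J\<close> is a multiple of \<open>3 * k\<close>.\<close>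
    then have "real (k * d) * (real (card J) / real (3 * k\<^sup>2))
        = real (k * d) * (1 / real y) - (\<Sum>i\<in>{1..k} - J. real (k * d) * (1 / real (x i)))"
      by (simp only: right_diff_distrib sum_distrib_left)
    also have "\<dots> \<in> \<int>"
    proof (intro Ints_diff Ints_sum int)
      show "y \<in> {1..<3 * k}" using y by simp
      fix i assume "i \<in> {1..k} - J"
      then show "x i \<in> {1..<3 * k}" using red[of i] by (auto simp: J_def)
    qed
    finally obtain z :: int where "real (k * d) * (real (card J) / real (3 * k\<^sup>2)) = of_int z"
      by (auto elim: Ints_cases)
    then have "real d * real (card J) = of_int z * 3 * real k"
      using k3 by (simp add: field_simps power2_eq_square)
    then have "of_int (int (d * card J)) = (of_int (z * 3 * int k) :: real)"
      by simp
    then have "int (d * card J) = z * 3 * int k"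
      by (simp only: of_int_eq_iff)
    then have "int k dvd int (d * card J)"
      by simp
    then have "k dvd d * card J"
      by (simp only: int_dvd_int_iff)
    moreover have "coprime k d"
      using d(1) by (simp add: k)
    ultimately have dvd: "k dvd card J"
      by (simp add: coprime_dvd_mult_right_iff)
    \<comment> \<open>\<open>card J\<close> is a multiple of \<open>k\<close> and at most
      \<open>k\<close>; excluding \<open>0\<close> leaves only \<open>k\<close>.\<close>
    have "card J \<noteq> 0"
    proof
      assume "card J = 0"
      then have "J = {}" using J(1) by simp
      then have "x i \<in> {3..<3 * k}" if "i \<in> {1..k}" for i
        using red[of i] that by (auto simp: J_def)
      then show False
        using no_red_solution[of k x y] eq k3 y by (auto simp: y_def)
    qed
    then have "card {1..k} \<le> card J"
      using dvd by (auto dest: dvd_imp_le)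
    then have "J = {1..k}"
      using J by (intro card_seteq) auto
    then have "x i = 3 * k\<^sup>2" if "i \<in> {1..k}" for i
      using that unfolding J_def by blast
    then have "1 / real y = (\<Sum>i=1..k. 1 / real (3 * k\<^sup>2))"
      using eq by (simp add: y_def)
    also have "\<dots> = 1 / real (3 * k)"
      using k3 by (simp add: power2_eq_square)
    finally show False
      using y by simp
  qed
qed

theorem theorem1p2:
  fixes k :: nat
  assumes "k > 0"
  shows "((\<exists>m::nat. m > 0 \<and> k = 3 * 2 ^ m) \<longrightarrow> f2 k = 3 * k ^ 2) \<and>
         ((\<exists>p m :: nat. prime p \<and> odd p \<and> m > 0 \<and> k = p ^ m) \<longrightarrow> f2 k \<ge> 3 * k ^ 2 + 1)"
proof (intro conjI impI)
  assume "\<exists>m::nat. m > 0 \<and> k = 3 * 2 ^ m"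
  then obtain m :: nat where m: "m > 0" "k = 3 * 2 ^ m" by blast
  then have "3 \<le> k" by simp
  show "f2 k = 3 * k ^ 2"
    unfolding f2_def
  proof (rule Least_equality)
    show "0 < 3 * k\<^sup>2 \<and> (\<forall>c. mono_solution k (3 * k\<^sup>2) c)"
      using mono_solution_3_mult_power2[OF m] assms by simp
    show "3 * k\<^sup>2 \<le> n" if "0 < n \<and> (\<forall>c. mono_solution k n c)" for n
      using no_mono_solution_below[OF \<open>3 \<le> k\<close>, of n] that by force
  qed
next
  assume "\<exists>p m :: nat. prime p \<and> odd p \<and> m > 0 \<and> k = p ^ m"
  then obtain p m :: nat where pm: "prime p" "odd p" "m > 0" "k = p ^ m" by blast
  have "2 \<le> k"
    using power_increasing[of 1 m p] prime_ge_2_nat[OF pm(1)] pm(3) by (simp add: pm(4))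
  \<comment> \<open>Existence ensures that \<open>LEAST\<close> is attained, so every coloring has a
    solution at \<open>f2 k\<close>; if \<open>f2 k \<le> 3 * k\<^sup>2\<close>, monotonicity would
    carry this over to \<open>3 * k\<^sup>2\<close>.\<close>
  then obtain n0 where "0 < n0 \<and> (\<forall>c. mono_solution k n0 c)"
    using ex_mono_solution by blast
  then have "0 < f2 k \<and> (\<forall>c. mono_solution k (f2 k) c)"
    unfolding f2_def by (rule LeastI)
  then have "\<not> f2 k \<le> 3 * k\<^sup>2"
    using no_mono_solution_prime_power[OF pm] mono_solution_mono by blast
  then show "3 * k ^ 2 + 1 \<le> f2 k"
    by simp
qed

end
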